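(* Let $n,k\ge 1$ be integers and let $\mathrm N_{n,k}=F_n/\gamma_{k+1}F_n$ be the free nilpotent group of rank $n$ and step $k$ with basis $X=\{x_1,\dots,x_n\}$. Then the monoid (under composition) $\Pi A(\mathrm N_{n,k})$ of palindromic automorphisms of $\mathrm N_{n,k}$ with respect to $X$ is a group.
   Context: $F_n$ is the free group on $x_1,\dots,x_n$ and $\gamma_mG$ is the $m$-th term of the lower central series of $G$ (with $\gamma_1G=G$). The images of the $x_i$ in $\mathrm N_{n,k}$ are again denoted $x_i$. A word $x_{i_1}^{\varepsilon_1}\cdots x_{i_m}^{\varepsilon_m}$ ($\varepsilon_j=\pm1$) in $X^{\pm1}$ is a palindrome if it coincides letter by letter with its reverse word $x_{i_m}^{\varepsilon_m}\cdots x_{i_1}^{\varepsilon_1}$. An element of $\mathrm N_{n,k}$ is a palindrome if it can be represented by some word in $X^{\pm1}$ that is a palindrome. An automorphism $\phi$ of $\mathrm N_{n,k}$ is a palindromic automorphism if $x_i^{\phi}$ (the image of $x_i$ under $\phi$) is a palindrome for every $1\le i\le n$. $\Pi A(\mathrm N_{n,k})$ is the set of all palindromic automorphisms of $\mathrm N_{n,k}$. *)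

theory Defs
  imports "HOL-Algebra.Algebra"
begin

section \<open>The free group on \<open>x\<^sub>1, \<dots>, x\<^sub>n\<close>\<close>

text \<open>The letter \<open>(i, True)\<close> stands for \<open>x\<^sub>i\<close> and \<open>(i, False)\<close> for its formal inverse.\<close>

type_synonym letter = "nat \<times> bool"

definition words :: "nat \<Rightarrow> letter list set" where
  "words n = lists ({1..n} \<times> UNIV)"

text \<open>The equivalence relation on words generated by inserting and deleting adjacent
  pairs of mutually inverse letters.\<close>

inductive_set free_rel :: "nat \<Rightarrow> (letter list \<times> letter list) set" for n :: nat where
  cancel: "\<lbrakk>u \<in> words n; v \<in> words n; i \<in> {1..n}\<rbrakk>
           \<Longrightarrow> (u @ [(i, e), (i, \<not> e)] @ v, u @ v) \<in> free_rel n"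
| refl: "u \<in> words n \<Longrightarrow> (u, u) \<in> free_rel n"
| sym: "(u, v) \<in> free_rel n \<Longrightarrow> (v, u) \<in> free_rel n"
| trans: "\<lbrakk>(u, v) \<in> free_rel n; (v, w) \<in> free_rel n\<rbrakk> \<Longrightarrow> (u, w) \<in> free_rel n"

definition free_group :: "nat \<Rightarrow> letter list set monoid" where
  "free_group n =
     \<lparr>carrier = words n // free_rel n,
      monoid.mult = \<lambda>A B. \<Union>u\<in>A. \<Union>v\<in>B. free_rel n `` {u @ v},
      one = free_rel n `` {[]}\<rparr>"

definition free_gen :: "nat \<Rightarrow> nat \<Rightarrow> letter list set" where
  "free_gen n i = free_rel n `` {[(i, True)]}"


section \<open>The lower central series and free nilpotent groups\<close>

definition commutator_subgroup ::
    "('a, 'b) monoid_scheme \<Rightarrow> 'a set \<Rightarrow> 'a set \<Rightarrow> 'a set" where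
  "commutator_subgroup G H K =
     generate G (\<Union>h\<in>H. \<Union>k\<in>K.
       {h \<otimes>\<^bsub>G\<^esub> k \<otimes>\<^bsub>G\<^esub> inv\<^bsub>G\<^esub> h \<otimes>\<^bsub>G\<^esub> inv\<^bsub>G\<^esub> k})"

text \<open>The series is indexed from 1; the value at 0 is a dummy.\<close>

fun lower_central :: "('a, 'b) monoid_scheme \<Rightarrow> nat \<Rightarrow> 'a set" where
  "lower_central G 0 = carrier G"
| "lower_central G (Suc 0) = carrier G"
| "lower_central G (Suc (Suc m)) =
     commutator_subgroup G (lower_central G (Suc m)) (carrier G)"

definition free_nilpotent :: "nat \<Rightarrow> nat \<Rightarrow> letter list set set monoid" where
  "free_nilpotent n k = free_group n Mod lower_central (free_group n) (k + 1)"

definition nilpotent_gen :: "nat \<Rightarrow> nat \<Rightarrow> nat \<Rightarrow> letter list set set" where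
  "nilpotent_gen n k i =
     lower_central (free_group n) (k + 1) #>\<^bsub>free_group n\<^esub> free_gen n i"


section \<open>Palindromes and palindromic automorphisms\<close>

fun word_value :: "('a, 'b) monoid_scheme \<Rightarrow> (nat \<Rightarrow> 'a) \<Rightarrow> letter list \<Rightarrow> 'a" where
  "word_value G x [] = \<one>\<^bsub>G\<^esub>"
| "word_value G x ((i, e) # w) =
     (if e then x i else inv\<^bsub>G\<^esub> (x i)) \<otimes>\<^bsub>G\<^esub> word_value G x w"

definition palindrome :: "nat \<Rightarrow> nat \<Rightarrow> letter list set set \<Rightarrow> bool" where
  "palindrome n k a \<longleftrightarrow>
     (\<exists>w\<in>words n. rev w = w \<and> word_value (free_nilpotent n k) (nilpotent_gen n k) w = a)"

definition palindromic_autos ::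
    "nat \<Rightarrow> nat \<Rightarrow> (letter list set set \<Rightarrow> letter list set set) set" where
  "palindromic_autos n k =
     {\<phi> \<in> auto (free_nilpotent n k). \<forall>i\<in>{1..n}. palindrome n k (\<phi> (nilpotent_gen n k i))}"

text \<open>The palindromic automorphisms, with the composition and identity of the automorphism
  group of the free nilpotent group.\<close>

definition palindromic_auto_monoid ::
    "nat \<Rightarrow> nat \<Rightarrow> (letter list set set \<Rightarrow> letter list set set) monoid" where
  "palindromic_auto_monoid n k =
     (AutoGroup (free_nilpotent n k))\<lparr>carrier := palindromic_autos n k\<rparr>"

end

theory Submission
  imports Defs
begin

text \<open>
  Write \<open>G\<close> for the free nilpotent group and \<open>\<gamma>\<^sub>m\<close> for the terms of its lower central series, so
  that \<open>\<gamma>\<^sub>k\<^sub>+\<^sub>1\<close> is trivial.  Substituting palindromic words into a palindromic word gives a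
  palindromic word (\<open>palindromic_endo_pal\<close>), so palindromic endomorphisms are closed under
  composition, and the real issue is the inverse of a palindromic automorphism \<open>f\<close>.  A palindromic
  endomorphism \<open>g\<close> with \<open>f (g x\<^sub>i) = x\<^sub>i\<close> modulo \<open>\<gamma>\<^sub>m\<close> for all \<open>i\<close> is built by induction on \<open>m\<close>;
  at \<open>m = k + 1\<close> it agrees with the inverse of \<open>f\<close> on the basis.

  For \<open>m = 2\<close> one works in the abelianization.  There a palindrome is a square, or a basis element
  times a square.  Hence \<open>f\<close> maps the finite set of square classes of \<open>1, x\<^sub>1, \<dots>, x\<^sub>n\<close> into itself,
  and as \<open>f\<close> is injective it permutes this set.  So every \<open>x\<^sub>i\<close> is, modulo \<open>\<gamma>\<^sub>2\<close>, the image
  of some \<open>c b\<^sup>2\<close> with \<open>c\<close> equal to \<open>1\<close> or to a basis element, and this is represented by the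
  palindrome consisting of a word for \<open>b\<close>, the letter \<open>c\<close> (no letter if \<open>c = 1\<close>), and the reversed word
  (\<open>palindromic_auto_inverse_mod_derived\<close>).

  For the step put \<open>h = f \<circ> g\<close>, so that \<open>h x\<^sub>i = c\<^sub>i x\<^sub>i\<close> with \<open>c\<^sub>i \<in> \<gamma>\<^sub>m\<close>.  The endomorphism \<open>e\<close>
  with \<open>e x\<^sub>i = x\<^sub>i (h x\<^sub>i)\<^sup>-\<^sup>1 x\<^sub>i\<close> is visibly palindromic.  Since \<open>h\<close> induces the identity on
  the abelianization, it acts trivially on \<open>\<gamma>\<^sub>m / \<gamma>\<^sub>m\<^sub>+\<^sub>1\<close>, hence \<open>h c\<^sub>i = c\<^sub>i\<close> modulo
  \<open>\<gamma>\<^sub>m\<^sub>+\<^sub>1\<close>.  It follows that \<open>h (e x\<^sub>i) = x\<^sub>i\<close> modulo \<open>\<gamma>\<^sub>m\<^sub>+\<^sub>1\<close>, and \<open>g \<circ> e\<close> is the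
  required refinement of \<open>g\<close> (\<open>palindromic_inverse_lift\<close>).

  Freeness enters only through the existence of endomorphisms with prescribed values on the basis;
  this and the other facts about \<open>G\<close> that the argument needs are collected in the locale
  \<open>free_nilpotent_basis\<close>.
\<close>

section \<open>Commutators and the lower central series\<close>

abbreviation commutator :: "('a, 'b) monoid_scheme \<Rightarrow> 'a \<Rightarrow> 'a \<Rightarrow> 'a" where
  "commutator G a b \<equiv> a \<otimes>\<^bsub>G\<^esub> b \<otimes>\<^bsub>G\<^esub> inv\<^bsub>G\<^esub> a \<otimes>\<^bsub>G\<^esub> inv\<^bsub>G\<^esub> b"

lemma (in group) inv_cancel_left [simp]:
  assumes "a \<in> carrier G" "b \<in> carrier G"
  shows "inv a \<otimes> (a \<otimes> b) = b" and "a \<otimes> (inv a \<otimes> b) = b"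
  using assms by (simp_all flip: m_assoc)

lemma (in group) commutator_absorb_left:
  assumes "z \<in> carrier G" "a \<in> carrier G" "b \<in> carrier G"
    and zb: "z \<otimes> b = b \<otimes> z"
    and zc: "z \<otimes> commutator G a b = commutator G a b \<otimes> z"
  shows "commutator G (z \<otimes> a) b = commutator G a b"
proof -
  have inv_zb: "inv z \<otimes> inv b = inv b \<otimes> inv z"
    using zb assms(1,3) by (metis inv_mult_group)
  have "commutator G (z \<otimes> a) b = z \<otimes> a \<otimes> b \<otimes> inv a \<otimes> (inv z \<otimes> inv b)"
    using assms(1-3) by (simp add: inv_mult_group m_assoc)
  also have "\<dots> = z \<otimes> commutator G a b \<otimes> inv z"
    unfolding inv_zb using assms(1-3) by (simp add: m_assoc)
  also have "\<dots> = commutator G a b"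
    unfolding zc using assms(1-3) by (simp add: m_assoc)
  finally show ?thesis .
qed

lemma (in group) commutator_absorb_right:
  assumes "z \<in> carrier G" "a \<in> carrier G" "b \<in> carrier G"
    and za: "z \<otimes> a = a \<otimes> z"
    and zc: "z \<otimes> commutator G a b = commutator G a b \<otimes> z"
  shows "commutator G a (z \<otimes> b) = commutator G a b"
proof -
  have "commutator G a (z \<otimes> b) = a \<otimes> z \<otimes> b \<otimes> inv a \<otimes> inv b \<otimes> inv z"
    using assms(1-3) by (simp add: inv_mult_group m_assoc)
  also have "\<dots> = z \<otimes> commutator G a b \<otimes> inv z"
    unfolding za[symmetric] using assms(1-3) by (simp add: m_assoc)
  also have "\<dots> = commutator G a b"
    unfolding zc using assms(1-3) by (simp add: m_assoc)
  finally show ?thesis .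
qed

lemma (in group) conjugation_hom:
  "a \<in> carrier G \<Longrightarrow> group_hom G G (\<lambda>g. a \<otimes> g \<otimes> inv a)"
  by unfold_locales (auto simp: hom_def m_assoc inv_solve_left)

lemma (in group_hom) hom_commutator:
  "a \<in> carrier G \<Longrightarrow> b \<in> carrier G \<Longrightarrow> h (commutator G a b) = commutator H (h a) (h b)"
  by simp

text \<open>Conjugation by \<open>a\<close> multiplies \<open>b\<close> and \<open>c\<close> by the central elements \<open>[a, b]\<close> and
  \<open>[a, c]\<close>, and central factors do not change the commutator \<open>[b, c]\<close>.\<close>

lemma (in group) commutes_with_commutator:
  assumes "a \<in> carrier G" "b \<in> carrier G" "c \<in> carrier G"
    and ab: "\<And>g. g \<in> carrier G \<Longrightarrow> commutator G a b \<otimes> g = g \<otimes> commutator G a b"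
    and ac: "\<And>g. g \<in> carrier G \<Longrightarrow> commutator G a c \<otimes> g = g \<otimes> commutator G a c"
  shows "a \<otimes> commutator G b c = commutator G b c \<otimes> a"
proof -
  define z w where "z = commutator G a b" and "w = commutator G a c"
  have zw: "z \<in> carrier G" "w \<in> carrier G"
    using assms(1-3) by (auto simp: z_def w_def)
  have "z \<otimes> b = a \<otimes> b \<otimes> inv a" "w \<otimes> c = a \<otimes> c \<otimes> inv a"
    using assms(1-3) by (auto simp: z_def w_def m_assoc)
  then have "a \<otimes> commutator G b c \<otimes> inv a = commutator G (z \<otimes> b) (w \<otimes> c)"
    using group_hom.hom_commutator[OF conjugation_hom] assms(1-3) by simp
  also have "\<dots> = commutator G b (w \<otimes> c)"
    by (rule commutator_absorb_left) (use assms(1-3) zw ab[folded z_def] in simp_all)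
  also have "\<dots> = commutator G b c"
    by (rule commutator_absorb_right) (use assms(1-3) zw ac[folded w_def] in simp_all)
  finally have "commutator G b c = a \<otimes> commutator G b c \<otimes> inv a" ..
  then show ?thesis
    by (subst (asm) inv_solve_right) (use assms(1-3) in simp_all)
qed

lemma lower_central_Suc:
  "m \<ge> 1 \<Longrightarrow> lower_central G (Suc m) = commutator_subgroup G (lower_central G m) (carrier G)"
  by (cases m) auto

lemma (in group) lower_central_subset: "lower_central G m \<subseteq> carrier G"
proof (induction m)
  case (Suc m)
  then have "(\<Union>g\<in>lower_central G m. \<Union>h\<in>carrier G. {commutator G g h}) \<subseteq> carrier G"
    by (auto simp: subset_eq)
  from generate_incl[OF this] show ?case
    by (cases m) (simp_all add: commutator_subgroup_def)
qed simp

lemma (in group) commutators_subset: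
  "(\<Union>g\<in>lower_central G m. \<Union>h\<in>carrier G. {commutator G g h}) \<subseteq> carrier G"
  using lower_central_subset[of m] by (auto simp: subset_eq)

lemma (in group) lower_central_subgroup: "subgroup (lower_central G m) G"
proof (cases "m \<ge> 2")
  case True
  then obtain j where "m = Suc j" "j \<ge> 1"
    by (cases m) auto
  then show ?thesis
    using generate_is_subgroup[OF commutators_subset]
    by (simp add: lower_central_Suc commutator_subgroup_def)
next
  case False
  then have "m = 0 \<or> m = Suc 0" by auto
  then show ?thesis by (auto simp: subgroup_self)
qed

lemma (in group) commutator_in_lower_central:
  assumes "m \<ge> 1" "g \<in> lower_central G m" "h \<in> carrier G"
  shows "commutator G g h \<in> lower_central G (Suc m)"
  unfolding lower_central_Suc[OF assms(1)] commutator_subgroup_def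
  by (rule generate.incl) (use assms in auto)

lemma (in group_hom) hom_lower_central_subset:
  "h ` lower_central G m \<subseteq> lower_central H m"
proof (induction m)
  case (Suc m)
  show ?case
  proof (cases "m = 0")
    case False
    then have m: "m \<ge> 1" by simp
    let ?C = "\<Union>g\<in>lower_central G m. \<Union>k\<in>carrier G. {commutator G g k}"
    have "h ` ?C \<subseteq> lower_central H (Suc m)"
    proof clarify
      fix g k assume g: "g \<in> lower_central G m" "k \<in> carrier G"
      then have "g \<in> carrier G"
        using G.lower_central_subset by auto
      then have "h (commutator G g k) = commutator H (h g) (h k)"
        using g by simp
      then show "h (commutator G g k) \<in> lower_central H (Suc m)"
        using H.commutator_in_lower_central[OF m, of "h g" "h k"] g Suc.IH by auto
    qed
    then have "generate H (h ` ?C) \<subseteq> lower_central H (Suc m)"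
      by (rule H.generate_subgroup_incl[OF _ H.lower_central_subgroup])
    then show ?thesis
      using generate_img[OF G.commutators_subset] 
      by (simp only: lower_central_Suc[OF m, of G] commutator_subgroup_def)
  qed auto
qed auto

lemma (in group_hom) surj_lower_central_subset:
  assumes "h ` carrier G = carrier H"
  shows "lower_central H m \<subseteq> h ` lower_central G m"
proof (induction m)
  case (Suc m)
  show ?case
  proof (cases "m = 0")
    case False
    then have m: "m \<ge> 1" by simp
    let ?C = "\<Union>g\<in>lower_central G m. \<Union>k\<in>carrier G. {commutator G g k}"
    have "(\<Union>g\<in>lower_central H m. \<Union>k\<in>carrier H. {commutator H g k}) \<subseteq> h ` ?C"
    proof clarify
      fix g k assume g: "g \<in> lower_central H m" "k \<in> carrier H"
      then have "g \<in> h ` lower_central G m" "k \<in> h ` carrier G"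
        using Suc.IH assms by blast+
      then obtain g' k' where g': "g' \<in> lower_central G m" "g = h g'"
        and k': "k' \<in> carrier G" "k = h k'"
        by blast
      have "g' \<in> carrier G"
        using g'(1) G.lower_central_subset by blast
      then have eq: "h (commutator G g' k') = commutator H g k"
        unfolding g' k' using k'(1) by (rule hom_commutator)
      have "commutator G g' k' \<in> ?C"
        using g'(1) k'(1) by blast
      then show "commutator H g k \<in> h ` ?C"
        unfolding eq[symmetric] by (rule imageI)
    qed
    then have "generate H (\<Union>g\<in>lower_central H m. \<Union>k\<in>carrier H. {commutator H g k})
        \<subseteq> generate H (h ` ?C)"
      by (rule H.mono_generate)
    then show ?thesis
      using generate_img[OF G.commutators_subset] 
      by (simp only: lower_central_Suc[OF m] commutator_subgroup_def)
  qed (use assms in auto)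
qed (use assms in auto)

text \<open>Conjugations are endomorphisms, and the terms of the lower central series are fully invariant.\<close>

lemma (in group) lower_central_normal: "lower_central G m \<lhd> G"
proof (rule normal_invI[OF lower_central_subgroup])
  fix x g assume x: "x \<in> carrier G" and g: "g \<in> lower_central G m"
  interpret conj: group_hom G G "\<lambda>g. x \<otimes> g \<otimes> inv x"
    using x by (rule conjugation_hom)
  show "x \<otimes> g \<otimes> inv x \<in> lower_central G m"
    using conj.hom_lower_central_subset[of m] g by (rule subsetD[OF _ imageI])
qed

lemma (in group) lower_central_Suc_subset: "lower_central G (Suc m) \<subseteq> lower_central G m"
proof (cases "m = 0")
  case False
  then have m: "m \<ge> 1" by simp
  interpret N: normal "lower_central G m" G
    by (rule lower_central_normal)
  have "(\<Union>g\<in>lower_central G m. \<Union>h\<in>carrier G. {commutator G g h}) \<subseteq> lower_central G m"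
  proof clarify
    fix g h assume g: "g \<in> lower_central G m" "h \<in> carrier G"
    have "g \<otimes> (h \<otimes> inv g \<otimes> inv h) \<in> lower_central G m"
      using g N.inv_op_closed2[of h "inv g"] by simp
    then show "commutator G g h \<in> lower_central G m"
      using g by (simp add: m_assoc N.mem_carrier)
  qed
  then show ?thesis
    unfolding lower_central_Suc[OF m] commutator_subgroup_def
    by (rule generate_subgroup_incl[OF _ lower_central_subgroup])
qed simp

lemma (in group) lower_central_antimono: "i \<le> j \<Longrightarrow> lower_central G j \<subseteq> lower_central G i"
  using lift_Suc_antimono_le[of "lower_central G"] lower_central_Suc_subset by blast

section \<open>Congruence modulo a term of the lower central series\<close>

abbreviation lower_central_class ::
    "('a, 'b) monoid_scheme \<Rightarrow> nat \<Rightarrow> 'a \<Rightarrow> 'a set" where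
  "lower_central_class G m g \<equiv> lower_central G m #>\<^bsub>G\<^esub> g"

lemma (in group) r_coset_eq_iff:
  assumes "subgroup H G" "a \<in> carrier G" "b \<in> carrier G"
  shows "H #> a = H #> b \<longleftrightarrow> (\<exists>z\<in>H. a = z \<otimes> b)"
proof
  assume "H #> a = H #> b"
  then have "a \<in> H #> b"
    using assms rcos_self by metis
  then show "\<exists>z\<in>H. a = z \<otimes> b"
    by (auto simp: r_coset_def)
next
  assume "\<exists>z\<in>H. a = z \<otimes> b"
  then have "a \<in> H #> b"
    by (auto simp: r_coset_def)
  then show "H #> a = H #> b"
    using assms repr_independence by metis
qed

lemmas (in group) lower_central_class_eq_iff = r_coset_eq_iff[OF lower_central_subgroup]

lemma (in group) lower_central_quotient_hom:
  "group_hom G (G Mod lower_central G m) (lower_central_class G m)"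
  by (intro group_hom.intro group_hom_axioms.intro group_axioms
      normal.factorgroup_is_group normal.r_coset_hom_Mod lower_central_normal)

lemma (in group) lower_central_class_mult:
  assumes "a \<in> carrier G" "b \<in> carrier G"
  shows "lower_central_class G m (a \<otimes> b)
    = lower_central_class G m a \<otimes>\<^bsub>G Mod lower_central G m\<^esub> lower_central_class G m b"
  by (rule group_hom.hom_mult[OF lower_central_quotient_hom assms])

lemma (in group) lower_central_class_coarsen:
  assumes "i \<le> j" "lower_central_class G j a = lower_central_class G j b"
    "a \<in> carrier G" "b \<in> carrier G"
  shows "lower_central_class G i a = lower_central_class G i b"
  using assms lower_central_antimono[OF assms(1)] by (auto simp: lower_central_class_eq_iff)

lemma (in group_hom) hom_lower_central_class:
  assumes "lower_central_class G m a = lower_central_class G m b" "a \<in> carrier G" "b \<in> carrier G"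
  shows "lower_central_class H m (h a) = lower_central_class H m (h b)"
proof -
  obtain z where z: "z \<in> lower_central G m" "a = z \<otimes> b"
    using assms by (auto simp: G.lower_central_class_eq_iff)
  then have "z \<in> carrier G"
    using G.lower_central_subset by auto
  then have "h a = h z \<otimes>\<^bsub>H\<^esub> h b"
    using z assms by simp
  moreover have "h z \<in> lower_central H m"
    using z hom_lower_central_subset[of m] by auto
  ultimately have "\<exists>y\<in>lower_central H m. h a = y \<otimes>\<^bsub>H\<^esub> h b"
    by blast
  then show ?thesis
    using assms(2,3) by (subst H.lower_central_class_eq_iff) simp_all
qed

lemma (in group) lower_central_class_central:
  assumes "m \<ge> 1" "g \<in> lower_central G m" "h \<in> carrier G"
  shows "lower_central_class G (Suc m) (g \<otimes> h) = lower_central_class G (Suc m) (h \<otimes> g)"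
proof -
  have g: "g \<in> carrier G"
    using assms lower_central_subset by auto
  have "g \<otimes> h = commutator G g h \<otimes> (h \<otimes> g)"
    using assms(3) g by (simp add: m_assoc)
  then show ?thesis
    using commutator_in_lower_central[OF assms] g assms(3)
    by (subst lower_central_class_eq_iff) auto
qed

lemma equalizer_subgroup:
  assumes "group_hom G H f" "group_hom G H g"
  shows "subgroup {a \<in> carrier G. f a = g a} G"
proof -
  interpret f: group_hom G H f by fact
  interpret g: group_hom G H g by fact
  show ?thesis
    by (rule f.G.subgroupI) (auto intro: exI[of _ "\<one>\<^bsub>G\<^esub>"])
qed

text \<open>This is the case \<open>[\<gamma>\<^sub>m, \<gamma>\<^sub>2] \<subseteq> \<gamma>\<^sub>m\<^sub>+\<^sub>2\<close> of the usual bound on commutators of terms of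
  the lower central series.  Modulo \<open>\<gamma>\<^sub>m\<^sub>+\<^sub>2\<close> the commutators of \<open>a\<close> are central, so \<open>a\<close>
  commutes with all commutators, and these generate \<open>\<gamma>\<^sub>2\<close>.\<close>

lemma (in group) lower_central_commutes_with_derived:
  assumes "m \<ge> 1" and a: "a \<in> lower_central G m" and b: "b \<in> lower_central G 2"
  shows "lower_central_class G (Suc (Suc m)) (a \<otimes> b) = lower_central_class G (Suc (Suc m)) (b \<otimes> a)"
proof -
  \<comment> \<open>A name for the quotient keeps its multiplication from being unfolded to products of sets.\<close>
  define Q where "Q = G Mod lower_central G (Suc (Suc m))"
  define p where "p = lower_central_class G (Suc (Suc m))"
  interpret p: group_hom G Q p
    unfolding Q_def p_def by (rule lower_central_quotient_hom)
  have surj: "p ` carrier G = carrier Q"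
    by (simp add: p_def Q_def carrier_FactGroup)
  have aG: "a \<in> carrier G" and bG: "b \<in> carrier G"
    using a b lower_central_subset by auto
  have central: "p g \<otimes>\<^bsub>Q\<^esub> y = y \<otimes>\<^bsub>Q\<^esub> p g"
    if g: "g \<in> lower_central G (Suc m)" and y: "y \<in> carrier Q" for g y
  proof -
    obtain h where h: "h \<in> carrier G" "y = p h"
      using surj y by blast
    have "p (g \<otimes> h) = p (h \<otimes> g)"
      using lower_central_class_central[of "Suc m" g h] g h(1) by (simp add: p_def)
    then show ?thesis
      using g h lower_central_subset[of "Suc m"] by (auto simp: subset_eq)
  qed
  have "generate Q (\<Union>x\<in>carrier Q. \<Union>y\<in>carrier Q. {commutator Q x y})
      \<subseteq> {c \<in> carrier Q. p a \<otimes>\<^bsub>Q\<^esub> c \<otimes>\<^bsub>Q\<^esub> inv\<^bsub>Q\<^esub> p a = c}"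
  proof (rule p.H.generate_subgroup_incl)
    show "subgroup {c \<in> carrier Q. p a \<otimes>\<^bsub>Q\<^esub> c \<otimes>\<^bsub>Q\<^esub> inv\<^bsub>Q\<^esub> p a = c} Q"
    proof (rule equalizer_subgroup)
      show "group_hom Q Q (\<lambda>c. p a \<otimes>\<^bsub>Q\<^esub> c \<otimes>\<^bsub>Q\<^esub> inv\<^bsub>Q\<^esub> p a)"
        using aG by (intro p.H.conjugation_hom) simp
      show "group_hom Q Q (\<lambda>c. c)"
        by unfold_locales (auto simp: hom_def)
    qed
  next
    have comm: "commutator Q (p a) y \<otimes>\<^bsub>Q\<^esub> g = g \<otimes>\<^bsub>Q\<^esub> commutator Q (p a) y"
      if y_in: "y \<in> carrier Q" and g_in: "g \<in> carrier Q" for y g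
    proof -
      obtain h where h: "h \<in> carrier G" and y: "y = p h"
        using y_in surj by blast
      have "p (commutator G a h) = commutator Q (p a) y"
        unfolding y by (rule p.hom_commutator[OF aG h])
      then show ?thesis
        using central[OF commutator_in_lower_central[OF assms(1) a h] g_in] by (simp only:)
    qed
    show "(\<Union>x\<in>carrier Q. \<Union>y\<in>carrier Q. {commutator Q x y})
      \<subseteq> {c \<in> carrier Q. p a \<otimes>\<^bsub>Q\<^esub> c \<otimes>\<^bsub>Q\<^esub> inv\<^bsub>Q\<^esub> p a = c}"
    proof clarify
      fix x y assume xy: "x \<in> carrier Q" "y \<in> carrier Q"
      then have "p a \<otimes>\<^bsub>Q\<^esub> commutator Q x y = commutator Q x y \<otimes>\<^bsub>Q\<^esub> p a"
        using aG comm by (intro p.H.commutes_with_commutator) simp_all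
      then have "p a \<otimes>\<^bsub>Q\<^esub> commutator Q x y \<otimes>\<^bsub>Q\<^esub> inv\<^bsub>Q\<^esub> p a
          = commutator Q x y \<otimes>\<^bsub>Q\<^esub> p a \<otimes>\<^bsub>Q\<^esub> inv\<^bsub>Q\<^esub> p a"
        by (rule arg_cong)
      also have "\<dots> = commutator Q x y"
        using xy aG by (simp add: p.H.m_assoc)
      finally show "commutator Q x y \<in> carrier Q \<and>
          p a \<otimes>\<^bsub>Q\<^esub> commutator Q x y \<otimes>\<^bsub>Q\<^esub> inv\<^bsub>Q\<^esub> p a = commutator Q x y"
        using xy by simp
    qed
  qed
  moreover have "p b \<in> lower_central Q 2"
    using p.hom_lower_central_subset[of 2] b by auto
  ultimately have eq: "p a \<otimes>\<^bsub>Q\<^esub> p b \<otimes>\<^bsub>Q\<^esub> inv\<^bsub>Q\<^esub> p a = p b"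
    by (auto simp: numeral_2_eq_2 commutator_subgroup_def)
  have "p a \<otimes>\<^bsub>Q\<^esub> p b = p a \<otimes>\<^bsub>Q\<^esub> p b \<otimes>\<^bsub>Q\<^esub> inv\<^bsub>Q\<^esub> p a \<otimes>\<^bsub>Q\<^esub> p a"
    using aG bG by (simp add: p.H.m_assoc)
  then have "p a \<otimes>\<^bsub>Q\<^esub> p b = p b \<otimes>\<^bsub>Q\<^esub> p a"
    unfolding eq .
  then have "p (a \<otimes> b) = p (b \<otimes> a)"
    using aG bG by simp
  then show ?thesis
    by (simp add: p_def)
qed

text \<open>By induction along the series, because a generator \<open>[a, b]\<close> with \<open>a \<in> \<gamma>\<^sub>m\<close> is sent to
  \<open>[z a, \<beta> b]\<close> with \<open>z \<in> \<gamma>\<^sub>m\<^sub>+\<^sub>1\<close> and \<open>\<beta> \<in> \<gamma>\<^sub>2\<close>, and both new factors are absorbed modulo \<open>\<gamma>\<^sub>m\<^sub>+\<^sub>2\<close>.\<close>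

lemma (in group) IA_endomorphism_trivial_on_factors:
  assumes f: "f \<in> hom G G"
    and IA: "\<And>g. g \<in> carrier G \<Longrightarrow> lower_central_class G 2 (f g) = lower_central_class G 2 g"
    and "m \<ge> 1" "c \<in> lower_central G m"
  shows "lower_central_class G (Suc m) (f c) = lower_central_class G (Suc m) c"
  using assms(3,4)
proof (induction m arbitrary: c rule: dec_induct)
  case base
  then show ?case
    using IA by (simp add: numeral_2_eq_2)
next
  case (step m)
  interpret f: group_hom G G f
    by unfold_locales (rule f)
  define Q where "Q = G Mod lower_central G (Suc (Suc m))"
  define p where "p = lower_central_class G (Suc (Suc m))"
  interpret p: group_hom G Q p
    unfolding Q_def p_def by (rule lower_central_quotient_hom)
  let ?E = "{c \<in> carrier G. (p \<circ> f) c = p c}"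
  have commute: "p g \<otimes>\<^bsub>Q\<^esub> p h = p h \<otimes>\<^bsub>Q\<^esub> p g"
    if "g \<in> lower_central G (Suc m)" "h \<in> carrier G" for g h
  proof -
    have "p (g \<otimes> h) = p (h \<otimes> g)"
      using lower_central_class_central[of "Suc m" g h] that by (simp add: p_def)
    then show ?thesis
      using that lower_central_subset[of "Suc m"] by (auto simp: subset_eq)
  qed
  have "(\<Union>g\<in>lower_central G m. \<Union>h\<in>carrier G. {commutator G g h}) \<subseteq> ?E"
  proof clarify
    fix a b assume a: "a \<in> lower_central G m" and b: "b \<in> carrier G"
    have aG: "a \<in> carrier G"
      using a lower_central_subset by auto
    obtain z where z: "z \<in> lower_central G (Suc m)" "f a = z \<otimes> a"
      using step.IH[OF a] aG by (auto simp: lower_central_class_eq_iff)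
    obtain d where d: "d \<in> lower_central G 2" "f b = d \<otimes> b"
      using IA[OF b] b by (auto simp: lower_central_class_eq_iff)
    have zdG: "z \<in> carrier G" "d \<in> carrier G"
      using z(1) d(1) lower_central_subset by blast+
    have ab: "commutator G a b \<in> lower_central G (Suc m)"
      using commutator_in_lower_central a b step.hyps by simp
    have da: "p d \<otimes>\<^bsub>Q\<^esub> p a = p a \<otimes>\<^bsub>Q\<^esub> p d"
    proof -
      have "p (a \<otimes> d) = p (d \<otimes> a)"
        using lower_central_commutes_with_derived[OF step.hyps(1) a d(1)] by (simp add: p_def)
      then show ?thesis
        using aG zdG by simp
    qed
    have pab: "p (commutator G a b) = commutator Q (p a) (p b)"
      using aG b by simp
    have absorb: "commutator Q (p a) (p d \<otimes>\<^bsub>Q\<^esub> p b) = commutator Q (p a) (p b)"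
      using da commute[OF ab zdG(2)] aG b zdG unfolding pab
      by (intro p.H.commutator_absorb_right) simp_all
    have "p (f (commutator G a b)) = commutator Q (p z \<otimes>\<^bsub>Q\<^esub> p a) (p d \<otimes>\<^bsub>Q\<^esub> p b)"
      using aG b zdG by (simp add: z(2) d(2) p.H.m_assoc p.H.inv_mult_group)
    also have "\<dots> = commutator Q (p a) (p d \<otimes>\<^bsub>Q\<^esub> p b)"
    proof (rule p.H.commutator_absorb_left)
      show "p z \<otimes>\<^bsub>Q\<^esub> (p d \<otimes>\<^bsub>Q\<^esub> p b) = p d \<otimes>\<^bsub>Q\<^esub> p b \<otimes>\<^bsub>Q\<^esub> p z"
        using commute[OF z(1), of "d \<otimes> b"] zdG b by simp
      show "p z \<otimes>\<^bsub>Q\<^esub> commutator Q (p a) (p d \<otimes>\<^bsub>Q\<^esub> p b)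
          = commutator Q (p a) (p d \<otimes>\<^bsub>Q\<^esub> p b) \<otimes>\<^bsub>Q\<^esub> p z"
        unfolding absorb pab[symmetric] by (rule commute[OF z(1)]) (use aG b in simp)
    qed (use aG b zdG in simp_all)
    also have "\<dots> = p (commutator G a b)"
      unfolding absorb pab ..
    finally show "commutator G a b \<in> carrier G \<and> (p \<circ> f) (commutator G a b) = p (commutator G a b)"
      using aG b by simp
  qed
  moreover have "group_hom G Q (p \<circ> f)"
    by unfold_locales (rule Group.hom_compose[OF f p.homh])
  then have "subgroup ?E G"
    by (rule equalizer_subgroup) (rule p.group_hom_axioms)
  ultimately have "lower_central G (Suc m) \<subseteq> ?E"
    unfolding lower_central_Suc[OF step.hyps(1)] commutator_subgroup_def
    by (rule generate_subgroup_incl)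
  then show ?case
    using step.prems by (auto simp: p_def)
qed

lemma (in group) abelianization_comm_group: "comm_group (G Mod lower_central G 2)"
proof -
  interpret p: group_hom G "G Mod lower_central G 2" "lower_central_class G 2"
    by (rule lower_central_quotient_hom)
  show ?thesis
  proof (rule p.H.group_comm_groupI)
    fix a b assume "a \<in> carrier (G Mod lower_central G 2)" "b \<in> carrier (G Mod lower_central G 2)"
    then obtain g h where g: "g \<in> carrier G" "a = lower_central_class G 2 g"
      and h: "h \<in> carrier G" "b = lower_central_class G 2 h"
      unfolding carrier_FactGroup by blast
    have "lower_central_class G 2 (g \<otimes> h) = lower_central_class G 2 (h \<otimes> g)"
      using lower_central_class_central[of 1 g h] g(1) h(1) by (simp add: numeral_2_eq_2)
    then show "a \<otimes>\<^bsub>G Mod lower_central G 2\<^esub> b = b \<otimes>\<^bsub>G Mod lower_central G 2\<^esub> a"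
      by (simp only: lower_central_class_mult[OF g(1) h(1)] lower_central_class_mult[OF h(1) g(1)] g(2) h(2))
  qed
qed

section \<open>Values of words\<close>

abbreviation flip_word :: "letter list \<Rightarrow> letter list" where
  "flip_word \<equiv> map (apsnd Not)"

lemma words_append [simp]: "u @ v \<in> words n \<longleftrightarrow> u \<in> words n \<and> v \<in> words n"
  by (auto simp: words_def)

lemma words_Cons [simp]: "(i, e) # w \<in> words n \<longleftrightarrow> i \<in> {1..n} \<and> w \<in> words n"
  by (auto simp: words_def)

lemma words_Nil [simp]: "[] \<in> words n"
  by (auto simp: words_def)

lemma words_rev [simp]: "rev w \<in> words n \<longleftrightarrow> w \<in> words n"
  by (auto simp: words_def)

lemma words_flip [simp]: "flip_word w \<in> words n \<longleftrightarrow> w \<in> words n"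
  by (induction w) auto

context group
begin

lemma word_value_closed [simp]:
  "x \<in> {1..n} \<rightarrow> carrier G \<Longrightarrow> w \<in> words n \<Longrightarrow> word_value G x w \<in> carrier G"
  by (induction w) (auto simp: Pi_iff)

lemma word_value_append:
  "x \<in> {1..n} \<rightarrow> carrier G \<Longrightarrow> u \<in> words n \<Longrightarrow> v \<in> words n \<Longrightarrow>
    word_value G x (u @ v) = word_value G x u \<otimes> word_value G x v"
proof (induction u)
  case (Cons l u)
  obtain i e where [simp]: "l = (i, e)" by (cases l)
  have "x i \<in> carrier G" using Cons.prems by auto
  then show ?case using Cons by (auto simp: m_assoc)
qed simp

lemma word_value_rev_flip:
  "x \<in> {1..n} \<rightarrow> carrier G \<Longrightarrow> w \<in> words n \<Longrightarrow>
    word_value G x (rev (flip_word w)) = inv (word_value G x w)"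
proof (induction w)
  case (Cons l w)
  obtain i e where [simp]: "l = (i, e)" by (cases l)
  have "x i \<in> carrier G" using Cons.prems by auto
  then show ?case
    using Cons by (auto simp: word_value_append[where n = n] inv_mult_group)
qed simp

lemma word_value_cong:
  "(\<And>i. i \<in> {1..n} \<Longrightarrow> x i = y i) \<Longrightarrow> w \<in> words n \<Longrightarrow> word_value G x w = word_value G y w"
  by (induction w) auto

end

lemma (in group_hom) hom_word_value:
  "x \<in> {1..n} \<rightarrow> carrier G \<Longrightarrow> w \<in> words n \<Longrightarrow>
    h (word_value G x w) = word_value H (\<lambda>i. h (x i)) w"
proof (induction w)
  case (Cons l w)
  obtain i e where [simp]: "l = (i, e)" by (cases l)
  have "x i \<in> carrier G" using Cons.prems by auto
  then show ?case using Cons by auto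
qed simp

text \<open>Substituting words for letters: \<open>s\<close> assigns a word to each of the \<open>2n\<close> letters.\<close>

lemma (in group) word_value_concat:
  assumes x: "x \<in> {1..n} \<rightarrow> carrier G"
    and s: "\<And>i e. i \<in> {1..n} \<Longrightarrow> s (i, e) \<in> words n"
    and inverse: "\<And>i. i \<in> {1..n} \<Longrightarrow>
      word_value G x (s (i, False)) = inv (word_value G x (s (i, True)))"
    and "w \<in> words n"
  shows "concat (map s w) \<in> words n"
    and "word_value G x (concat (map s w)) = word_value G (\<lambda>i. word_value G x (s (i, True))) w"
proof -
  have "concat (map s w) \<in> words n \<and>
    word_value G x (concat (map s w)) = word_value G (\<lambda>i. word_value G x (s (i, True))) w"
    using assms(4)
  proof (induction w)
    case (Cons l w)
    obtain i e where [simp]: "l = (i, e)" by (cases l)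
    show ?case
      using Cons s[of i] inverse[of i] x by (cases e) (auto simp: word_value_append)
  qed simp
  then show "concat (map s w) \<in> words n"
    and "word_value G x (concat (map s w)) = word_value G (\<lambda>i. word_value G x (s (i, True))) w"
    by auto
qed

lemma palindrome_list_cases:
  assumes "rev w = w"
  obtains (even) u where "w = u @ rev u" | (odd) u l where "w = u @ [l] @ rev u"
proof -
  define m where "m = length w div 2"
  define u where "u = take m w"
  show thesis
  proof (cases "even (length w)")
    case True
    then have len: "length w = m + m" by (auto simp: m_def)
    have "drop m w = rev (take m w)"
      using rev_take[of m w] assms len by simp
    then have "w = u @ rev u"
      unfolding u_def by (metis append_take_drop_id)
    then show ?thesis by (rule even)
  next
    case False
    then have len: "length w = Suc (m + m)" by (auto simp: m_def elim!: oddE)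
    have "drop (Suc m) w = rev (take m w)"
      using rev_take[of m w] assms len by simp
    then have "w = u @ [w ! m] @ rev u"
      using id_take_nth_drop[of m w] len by (simp add: u_def)
    then show ?thesis by (rule odd)
  qed
qed

section \<open>Palindromes in the abelianization and inverses of palindromic automorphisms\<close>

text \<open>The freeness condition speaks only of maps from the group to itself, which is what makes it possible
  to treat the group as a single object.\<close>

locale free_nilpotent_basis = group G for G (structure) +
  fixes x :: "nat \<Rightarrow> 'a" and n k :: nat
  assumes basis_closed: "x \<in> {1..n} \<rightarrow> carrier G"
    and basis_generates: "g \<in> carrier G \<Longrightarrow> \<exists>w\<in>words n. word_value G x w = g"
    and basis_extend: "f \<in> {1..n} \<rightarrow> carrier G \<Longrightarrow> \<exists>h\<in>hom G G. \<forall>i\<in>{1..n}. h (x i) = f i"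
    and nilpotent: "lower_central G (Suc k) = {\<one>}"
begin

definition pal :: "'a \<Rightarrow> bool" where
  "pal a \<longleftrightarrow> (\<exists>w\<in>words n. rev w = w \<and> word_value G x w = a)"

definition palindromic_endos :: "('a \<Rightarrow> 'a) set" where
  "palindromic_endos = {f \<in> hom G G. \<forall>i\<in>{1..n}. pal (f (x i))}"

lemma basis_mem [simp]: "1 \<le> i \<Longrightarrow> i \<le> n \<Longrightarrow> x i \<in> carrier G"
  using basis_closed by auto

lemmas basis_word_closed [simp] = word_value_closed[OF basis_closed]
lemmas basis_word_append = word_value_append[OF basis_closed]

lemma pal_closed: "pal a \<Longrightarrow> a \<in> carrier G"
  by (auto simp: pal_def)

lemma pal_basis: "i \<in> {1..n} \<Longrightarrow> pal (x i)"
  unfolding pal_def by (intro bexI[of _ "[(i, True)]"]) auto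

lemma hom_eq_on_basis:
  assumes "group H" "f \<in> hom G H" "g \<in> hom G H" "\<And>i. i \<in> {1..n} \<Longrightarrow> f (x i) = g (x i)"
    and "a \<in> carrier G"
  shows "f a = g a"
proof -
  interpret f: group_hom G H f
    by (intro group_hom.intro group_hom_axioms.intro group_axioms assms)
  interpret g: group_hom G H g
    by (intro group_hom.intro group_hom_axioms.intro group_axioms assms)
  obtain w where w: "w \<in> words n" "word_value G x w = a"
    using basis_generates assms by blast
  show ?thesis
    using f.hom_word_value[OF basis_closed w(1)] g.hom_word_value[OF basis_closed w(1)] w
      f.H.word_value_cong[of n "\<lambda>i. f (x i)" "\<lambda>i. g (x i)" w] assms(4) by simp
qed

lemma pal_word_flip:
  assumes "w \<in> words n" "rev w = w"
  shows "word_value G x (flip_word w) = inv (word_value G x w)"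
  using word_value_rev_flip[OF basis_closed assms(1)] assms(2) by (simp add: rev_map)

text \<open>Replace each letter of a palindromic word for \<open>a\<close> by a palindromic word for the image of that
  letter.  The inverse of a palindromic word is obtained by inverting each letter in place, so the
  words put in for the inverse letters are palindromic too, and reversing the result merely
  permutes its blocks as reversal permutes the letters of the original word.\<close>

lemma palindromic_endo_pal:
  assumes f: "f \<in> palindromic_endos" and "pal a"
  shows "pal (f a)"
proof -
  interpret f: group_hom G G f
    using f by unfold_locales (auto simp: palindromic_endos_def)
  obtain w where w: "w \<in> words n" "rev w = w" "word_value G x w = a"
    using \<open>pal a\<close> by (auto simp: pal_def)
  have "\<forall>i\<in>{1..n}. \<exists>v\<in>words n. rev v = v \<and> word_value G x v = f (x i)"
    using f by (auto simp: palindromic_endos_def pal_def)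
  then obtain v where v: "\<And>i. i \<in> {1..n} \<Longrightarrow> v i \<in> words n \<and> rev (v i) = v i \<and> word_value G x (v i) = f (x i)"
    by metis
  define s where "s = (\<lambda>(i, e). if e then v i else flip_word (v i))"
  let ?W = "concat (map s w)"
  have s: "s (i, e) \<in> words n" if "i \<in> {1..n}" for i e
    using v[OF that] by (simp add: s_def)
  have s_inv: "word_value G x (s (i, False)) = inv (word_value G x (s (i, True)))"
    if "i \<in> {1..n}" for i
    using v[OF that] by (simp add: s_def pal_word_flip)
  have "rev (s l) = s l" if "l \<in> set w" for l
    using that w(1) v by (auto simp: s_def words_def rev_map lists_eq_set split: prod.splits)
  then have "map rev (map s w) = map s w"
    by simp
  moreover have "rev ?W = concat (map rev (map s (rev w)))"
    by (simp add: rev_concat rev_map)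
  ultimately have "rev ?W = ?W"
    unfolding w(2) by (simp only:)
  moreover have "word_value G x ?W = f a"
  proof -
    have "word_value G x ?W = word_value G (\<lambda>i. word_value G x (s (i, True))) w"
      by (rule word_value_concat[OF basis_closed s s_inv w(1)])
    also have "\<dots> = word_value G (\<lambda>i. f (x i)) w"
      by (rule word_value_cong[OF _ w(1)]) (use v in \<open>simp add: s_def\<close>)
    also have "\<dots> = f a"
      using f.hom_word_value[OF basis_closed w(1)] w(3) by simp
    finally show ?thesis .
  qed
  ultimately show ?thesis
    using word_value_concat(1)[OF basis_closed s s_inv w(1)] by (auto simp: pal_def)
qed

lemma palindromic_endos_compose:
  assumes "f \<in> palindromic_endos" "g \<in> palindromic_endos"
  shows "f \<circ> g \<in> palindromic_endos"
  using assms Group.hom_compose[of g G G f G] palindromic_endo_pal[OF assms(1)]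
  by (auto simp: palindromic_endos_def)

lemma pal_reflect:
  assumes "i \<in> {1..n}" "pal y"
  shows "pal (x i \<otimes> inv y \<otimes> x i)"
proof -
  obtain w where w: "w \<in> words n" "rev w = w" "word_value G x w = y"
    using \<open>pal y\<close> by (auto simp: pal_def)
  let ?w = "[(i, True)] @ flip_word w @ [(i, True)]"
  have "word_value G x ?w = x i \<otimes> inv y \<otimes> x i"
    using assms w pal_closed[OF assms(2)]
    by (simp add: basis_word_append pal_word_flip m_assoc)
  moreover have "rev ?w = ?w"
    using w(2) by (simp add: rev_map)
  ultimately show ?thesis
    using assms w(1) unfolding pal_def by (intro bexI[of _ ?w]) auto
qed

lemma word_value_rev_abelianized:
  "w \<in> words n \<Longrightarrow> lower_central_class G 2 (word_value G x (rev w)) = lower_central_class G 2 (word_value G x w)"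
proof (induction w)
  case (Cons l w)
  define Q where "Q = G Mod lower_central G 2"
  define p where "p = lower_central_class G 2"
  interpret p: group_hom G Q p
    unfolding Q_def p_def by (rule lower_central_quotient_hom)
  interpret Q: comm_group Q
    unfolding Q_def by (rule abelianization_comm_group)
  obtain i e where l: "l = (i, e)" by (cases l)
  have i: "[l] \<in> words n" "w \<in> words n" using Cons.prems l by auto
  have "p (word_value G x (rev (l # w))) = p (word_value G x w) \<otimes>\<^bsub>Q\<^esub> p (word_value G x [l])"
    using Cons.IH i by (simp add: basis_word_append p_def[symmetric])
  also have "\<dots> = p (word_value G x [l]) \<otimes>\<^bsub>Q\<^esub> p (word_value G x w)"
    by (rule Q.m_comm) (use i in auto)
  also have "\<dots> = p (word_value G x ([l] @ w))"
    using i by (simp only: basis_word_append p.hom_mult basis_word_closed)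
  finally show ?case by (simp add: p_def)
qed simp

lemma word_value_double_abelianized:
  assumes "w \<in> words n" "v \<in> words n"
  shows "lower_central_class G 2 (word_value G x (w @ v @ rev w))
    = lower_central_class G 2 (word_value G x v \<otimes> word_value G x w \<otimes> word_value G x w)"
proof -
  define Q where "Q = G Mod lower_central G 2"
  define p where "p = lower_central_class G 2"
  interpret p: group_hom G Q p
    unfolding Q_def p_def by (rule lower_central_quotient_hom)
  interpret Q: comm_group Q
    unfolding Q_def by (rule abelianization_comm_group)
  have "p (word_value G x (rev w)) = p (word_value G x w)"
    unfolding p_def by (rule word_value_rev_abelianized[OF assms(1)])
  then have "p (word_value G x (w @ v @ rev w))
      = p (word_value G x v \<otimes> word_value G x w \<otimes> word_value G x w)"
    using assms by (simp add: basis_word_append Q.m_ac)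
  then show ?thesis by (simp add: p_def)
qed

text \<open>The two halves of a palindromic word have the same image in the abelianization and contribute a
  square.  A middle letter \<open>x\<^sub>i\<^sup>-\<^sup>1\<close> is \<open>x\<^sub>i\<close> times the square of \<open>x\<^sub>i\<^sup>-\<^sup>1\<close>.\<close>

lemma pal_abelianized:
  assumes "pal a"
  obtains b c where "b \<in> carrier G" "c \<in> insert \<one> (x ` {1..n})"
    "lower_central_class G 2 a = lower_central_class G 2 (c \<otimes> b \<otimes> b)"
proof -
  define Q where "Q = G Mod lower_central G 2"
  define p where "p = lower_central_class G 2"
  interpret p: group_hom G Q p
    unfolding Q_def p_def by (rule lower_central_quotient_hom)
  interpret Q: comm_group Q
    unfolding Q_def by (rule abelianization_comm_group)
  obtain w where w: "w \<in> words n" "rev w = w" "word_value G x w = a"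
    using assms by (auto simp: pal_def)
  from w(2) show thesis
  proof (cases rule: palindrome_list_cases)
    case (even u)
    then have u: "u \<in> words n" using w(1) by simp
    show ?thesis
    proof (rule that)
      show "word_value G x u \<in> carrier G" using u by simp
      show "lower_central_class G 2 a = lower_central_class G 2 (\<one> \<otimes> word_value G x u \<otimes> word_value G x u)"
        using word_value_double_abelianized[OF u, of "[]"] w(3) even by simp
    qed simp
  next
    case (odd u l)
    obtain i e where l: "l = (i, e)" by (cases l)
    have u: "u \<in> words n" and i: "i \<in> {1..n}" using odd w(1) by (auto simp: l)
    then have closed: "word_value G x u \<in> carrier G" "x i \<in> carrier G" using i by auto
    have a: "p a = p (word_value G x [l] \<otimes> word_value G x u \<otimes> word_value G x u)"
      using word_value_double_abelianized[OF u, of "[l]"] w(3) odd i by (simp add: l p_def)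
    show ?thesis
    proof (cases e)
      case True
      show ?thesis
        by (rule that[of "word_value G x u" "x i"])
          (use a closed i True in \<open>auto simp: l p_def\<close>)
    next
      case False
      have "p a = p (x i \<otimes> (inv (x i) \<otimes> word_value G x u) \<otimes> (inv (x i) \<otimes> word_value G x u))"
        using closed unfolding a l by (simp add: False Q.m_ac)
      then show ?thesis
        by (intro that[of "inv (x i) \<otimes> word_value G x u" "x i"])
          (use closed i in \<open>auto simp: p_def\<close>)
    qed
  qed
qed

lemma pal_of_abelianized:
  assumes "b \<in> carrier G" "c \<in> insert \<one> (x ` {1..n})"
  obtains q where "pal q" "lower_central_class G 2 q = lower_central_class G 2 (c \<otimes> b \<otimes> b)"
proof -
  obtain u where u: "u \<in> words n" "word_value G x u = b"
    using basis_generates assms by blast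
  obtain v where v: "v \<in> words n" "rev v = v" "word_value G x v = c"
  proof (cases "c = \<one>")
    case True
    then show thesis by (intro that[of "[]"]) auto
  next
    case False
    then obtain i where "i \<in> {1..n}" "c = x i" using assms(2) by auto
    then show thesis by (intro that[of "[(i, True)]"]) auto
  qed
  show thesis
  proof (rule that)
    show "pal (word_value G x (u @ v @ rev u))"
      using u v unfolding pal_def by (intro bexI[of _ "u @ v @ rev u"]) auto
    show "lower_central_class G 2 (word_value G x (u @ v @ rev u)) = lower_central_class G 2 (c \<otimes> b \<otimes> b)"
      using word_value_double_abelianized[OF u(1) v(1)] u(2) v(3) by simp
  qed
qed

text \<open>The preimage in the group of a coset of the subgroup of squares of the abelianization.\<close>

definition square_class :: "'a \<Rightarrow> 'a set" where
  "square_class g = {h \<in> carrier G. \<exists>b\<in>carrier G.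
     lower_central_class G 2 h = lower_central_class G 2 (g \<otimes> b \<otimes> b)}"

lemma square_class_self: "g \<in> carrier G \<Longrightarrow> g \<in> square_class g"
  unfolding square_class_def by (auto intro!: bexI[of _ \<one>])

lemma square_class_eq:
  assumes "g \<in> square_class g'" "g' \<in> carrier G"
  shows "square_class g = square_class g'"
proof -
  define Q where "Q = G Mod lower_central G 2"
  define p where "p = lower_central_class G 2"
  interpret p: group_hom G Q p
    unfolding Q_def p_def by (rule lower_central_quotient_hom)
  interpret Q: comm_group Q
    unfolding Q_def by (rule abelianization_comm_group)
  obtain a where a: "a \<in> carrier G" "p g = p (g' \<otimes> a \<otimes> a)" and g: "g \<in> carrier G"
    using assms by (auto simp: square_class_def p_def)
  \<comment> \<open>If \<open>h = g b\<^sup>2\<close> and \<open>g = g' a\<^sup>2\<close> modulo the derived subgroup, then \<open>h = g' (a b)\<^sup>2\<close>, and conversely.\<close>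
  have 1: "p (g \<otimes> b \<otimes> b) = p (g' \<otimes> (a \<otimes> b) \<otimes> (a \<otimes> b))" if "b \<in> carrier G" for b
    using that a g assms(2) by (simp add: Q.m_ac)
  have 2: "p (g' \<otimes> b \<otimes> b) = p (g \<otimes> (inv a \<otimes> b) \<otimes> (inv a \<otimes> b))" if "b \<in> carrier G" for b
  proof -
    have "p (g \<otimes> (inv a \<otimes> b) \<otimes> (inv a \<otimes> b)) = p (g' \<otimes> (a \<otimes> (inv a \<otimes> b)) \<otimes> (a \<otimes> (inv a \<otimes> b)))"
      by (rule 1) (use that a in simp)
    then show ?thesis using that a by simp
  qed
  show ?thesis
    unfolding square_class_def p_def[symmetric] using 1 2 a(1) by (auto; metis m_closed inv_closed)
qed

lemma auto_image_square_class:
  assumes f: "f \<in> auto G" and g: "g \<in> carrier G"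
  shows "f ` square_class g = square_class (f g)"
proof -
  have hom: "f \<in> hom G G" and bij: "bij_betw f (carrier G) (carrier G)"
    using f by (auto simp: auto_def Bij_def)
  let ?f' = "inv_into (carrier G) f"
  have hom': "?f' \<in> hom G G"
    using f restrict_inv_into_hom[of f] unfolding auto_def
    by (auto simp: hom_def Pi_iff)
  have sub: "h a \<in> square_class (h g)"
    if h: "h \<in> hom G G" and ag: "a \<in> square_class g" and g: "g \<in> carrier G" for h g a
  proof -
    interpret h: group_hom G G h by unfold_locales (rule h)
    obtain b where b: "b \<in> carrier G" "lower_central_class G 2 a = lower_central_class G 2 (g \<otimes> b \<otimes> b)"
      and a: "a \<in> carrier G"
      using ag by (auto simp: square_class_def)
    have "lower_central_class G 2 (h a) = lower_central_class G 2 (h g \<otimes> h b \<otimes> h b)"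
      using h.hom_lower_central_class[OF b(2)] a b(1) g by simp
    then show ?thesis
      using a b(1) by (auto simp: square_class_def)
  qed
  show ?thesis
  proof
    show "f ` square_class g \<subseteq> square_class (f g)"
      using sub[OF hom _ g] by blast
    show "square_class (f g) \<subseteq> f ` square_class g"
    proof
      fix a assume a: "a \<in> square_class (f g)"
      then have "a \<in> carrier G" by (simp add: square_class_def)
      then have "f (?f' a) = a"
        using bij by (simp add: bij_betw_inv_into_right)
      moreover have "f g \<in> carrier G"
        using hom g by (auto simp: hom_def)
      then have "?f' a \<in> square_class (?f' (f g))"
        by (rule sub[OF hom' a])
      then have "?f' a \<in> square_class g"
        using bij g by (simp add: bij_betw_inv_into_left)
      ultimately show "a \<in> f ` square_class g" by force
    qed
  qed
qed

text \<open>The image of a square class under \<open>f\<close> is a square class, so \<open>f\<close> acts on the square classes of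
  \<open>\<one>\<close> and the basis elements.  An injective map of this finite set into itself is surjective,
  which yields preimages of the classes of all basis elements.\<close>

lemma palindromic_auto_inverse_mod_derived:
  assumes f: "f \<in> auto G" "f \<in> palindromic_endos"
  shows "\<exists>g\<in>palindromic_endos. \<forall>i\<in>{1..n}. lower_central_class G 2 (f (g (x i))) = lower_central_class G 2 (x i)"
proof -
  have bij: "bij_betw f (carrier G) (carrier G)"
    using f by (auto simp: auto_def Bij_def)
  interpret f: group_hom G G f
    using f by unfold_locales (auto simp: auto_def)
  define B where "B = insert \<one> (x ` {1..n})"
  have B: "B \<subseteq> carrier G" by (auto simp: B_def)
  have closed: "(`) f ` (square_class ` B) \<subseteq> square_class ` B"
  proof clarify
    fix c assume c: "c \<in> B"
    have "pal (f c)"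
    proof (cases "c = \<one>")
      case True
      then show ?thesis by (auto simp: pal_def intro!: bexI[of _ "[]"])
    qed (use c f(2) in \<open>auto simp: B_def palindromic_endos_def\<close>)
    then obtain b c' where "b \<in> carrier G" "c' \<in> B"
      "lower_central_class G 2 (f c) = lower_central_class G 2 (c' \<otimes> b \<otimes> b)"
      unfolding B_def by (rule pal_abelianized)
    then have "f c \<in> square_class c'"
      using c B by (auto simp: square_class_def)
    then have "square_class (f c) = square_class c'"
      using \<open>c' \<in> B\<close> B by (intro square_class_eq) auto
    then show "f ` square_class c \<in> square_class ` B"
      using auto_image_square_class[OF f(1), of c] c B \<open>c' \<in> B\<close> by auto
  qed
  have "inj_on ((`) f) (square_class ` B)"
  proof (rule inj_onI)
    fix S T assume "S \<in> square_class ` B" "T \<in> square_class ` B" "f ` S = f ` T"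
    moreover from this have "S \<subseteq> carrier G" "T \<subseteq> carrier G"
      by (auto simp: square_class_def)
    ultimately show "S = T"
      using bij inj_on_image_eq_iff[of f "carrier G" S T] by (auto simp: bij_betw_def)
  qed
  then have perm: "(`) f ` (square_class ` B) = square_class ` B"
    using closed by (intro endo_inj_surj) (auto simp: B_def)
  have "\<forall>i\<in>{1..n}. \<exists>q. pal q \<and> lower_central_class G 2 (f q) = lower_central_class G 2 (x i)"
  proof
    fix i assume i: "i \<in> {1..n}"
    then have "square_class (x i) \<in> (`) f ` (square_class ` B)"
      unfolding perm by (auto simp: B_def)
    then obtain c where c: "c \<in> B" "square_class (x i) = f ` square_class c"
      by blast
    have cG: "c \<in> carrier G" using c B by blast
    have "x i \<in> f ` square_class c"
      using square_class_self[of "x i"] i c(2) by auto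
    then obtain a where "a \<in> square_class c" and xi: "x i = f a"
      by blast
    then obtain b where b: "b \<in> carrier G" "a \<in> carrier G"
      "lower_central_class G 2 a = lower_central_class G 2 (c \<otimes> b \<otimes> b)"
      by (auto simp: square_class_def)
    obtain q where q: "pal q" "lower_central_class G 2 q = lower_central_class G 2 (c \<otimes> b \<otimes> b)"
      using pal_of_abelianized[OF b(1)] c(1) unfolding B_def by blast
    have "lower_central_class G 2 (f q) = lower_central_class G 2 (f a)"
      by (rule f.hom_lower_central_class) (use q b pal_closed in auto)
    then show "\<exists>q. pal q \<and> lower_central_class G 2 (f q) = lower_central_class G 2 (x i)"
      using q(1) xi by auto
  qed
  then obtain q where q: "\<forall>i\<in>{1..n}. pal (q i) \<and> lower_central_class G 2 (f (q i)) = lower_central_class G 2 (x i)"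
    by metis
  then have "q \<in> {1..n} \<rightarrow> carrier G"
    using pal_closed by auto
  then obtain g where "g \<in> hom G G" "\<forall>i\<in>{1..n}. g (x i) = q i"
    using basis_extend by blast
  then show ?thesis
    using q by (intro bexI[of _ g]) (auto simp: palindromic_endos_def)
qed

text \<open>With \<open>h x\<^sub>i = c x\<^sub>i\<close> the reflected palindrome \<open>r\<^sub>i = x\<^sub>i (h x\<^sub>i)\<^sup>-\<^sup>1 x\<^sub>i\<close> is sent by \<open>h\<close> to
  \<open>c x\<^sub>i (h(c) c x\<^sub>i)\<^sup>-\<^sup>1 c x\<^sub>i\<close>, which collapses to \<open>x\<^sub>i\<close> as soon as \<open>h(c) = c\<close>; modulo the
  next term of the series this holds because \<open>h\<close> is the identity on the abelianization.\<close>

lemma palindromic_inverse_lift: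
  assumes f: "f \<in> palindromic_endos" and g: "g \<in> palindromic_endos" and m: "m \<ge> 2"
    and inverse: "\<forall>i\<in>{1..n}. lower_central_class G m (f (g (x i))) = lower_central_class G m (x i)"
  shows "\<exists>g'\<in>palindromic_endos. \<forall>i\<in>{1..n}.
    lower_central_class G (Suc m) (f (g' (x i))) = lower_central_class G (Suc m) (x i)"
proof -
  define h where "h = f \<circ> g"
  have h: "h \<in> palindromic_endos"
    unfolding h_def by (rule palindromic_endos_compose[OF f g])
  interpret h: group_hom G G h
    using h by unfold_locales (auto simp: palindromic_endos_def)
  define r where "r i = x i \<otimes> inv (h (x i)) \<otimes> x i" for i
  have r: "pal (r i)" if "i \<in> {1..n}" for i
    unfolding r_def using that h by (intro pal_reflect) (auto simp: palindromic_endos_def)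
  then have "r \<in> {1..n} \<rightarrow> carrier G"
    using pal_closed by auto
  then obtain e where e: "e \<in> hom G G" "\<forall>i\<in>{1..n}. e (x i) = r i"
    using basis_extend by blast
  then have "e \<in> palindromic_endos"
    using r by (auto simp: palindromic_endos_def)
  then have ge: "g \<circ> e \<in> palindromic_endos"
    by (rule palindromic_endos_compose[OF g])
  have IA: "lower_central_class G 2 (h a) = lower_central_class G 2 a" if "a \<in> carrier G" for a
  proof -
    interpret p: group_hom G "G Mod lower_central G 2" "lower_central_class G 2"
      by (rule lower_central_quotient_hom)
    have "(lower_central_class G 2 \<circ> h) a = lower_central_class G 2 a"
    proof (rule hom_eq_on_basis[OF p.H.group_axioms _ p.homh _ that])
      show "lower_central_class G 2 \<circ> h \<in> hom G (G Mod lower_central G 2)"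
        by (rule Group.hom_compose[OF h.homh p.homh])
      show "(lower_central_class G 2 \<circ> h) (x i) = lower_central_class G 2 (x i)" if "i \<in> {1..n}" for i
      proof -
        have "lower_central_class G 2 (h (x i)) = lower_central_class G 2 (x i)"
          by (rule lower_central_class_coarsen[OF m]) (use that inverse h.hom_closed[of "x i"] in \<open>auto simp: h_def\<close>)
        then show ?thesis by simp
      qed
    qed
    then show ?thesis by simp
  qed
  have "lower_central_class G (Suc m) (h (r i)) = lower_central_class G (Suc m) (x i)"
    if i: "i \<in> {1..n}" for i
  proof -
    define Q where "Q = G Mod lower_central G (Suc m)"
    define p where "p = lower_central_class G (Suc m)"
    interpret p: group_hom G Q p
      unfolding Q_def p_def by (rule lower_central_quotient_hom)
    have xi: "x i \<in> carrier G" using i by simp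
    obtain c where c: "c \<in> lower_central G m" "h (x i) = c \<otimes> x i"
      using inverse i xi h.hom_closed[OF xi] lower_central_class_eq_iff[of "h (x i)" "x i" m]
      by (auto simp: h_def)
    have cG: "c \<in> carrier G"
      using c(1) lower_central_subset by blast
    have "p (h c) = p c"
      unfolding p_def by (rule IA_endomorphism_trivial_on_factors[OF h.homh IA _ c(1)]) (use m in simp_all)
    moreover have "h (r i) = c \<otimes> x i \<otimes> inv (h c \<otimes> (c \<otimes> x i)) \<otimes> (c \<otimes> x i)"
      using xi cG by (simp add: r_def c(2))
    ultimately have "p (h (r i)) = p (x i)"
      using xi cG by (simp add: p.H.m_assoc p.H.inv_mult_group)
    then show ?thesis by (simp add: p_def)
  qed
  then show ?thesis
    using e ge by (intro bexI[of _ "g \<circ> e"]) (auto simp: h_def)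
qed

lemma palindromic_auto_right_inverse:
  assumes f: "f \<in> auto G" "f \<in> palindromic_endos" and "k \<ge> 1"
  shows "\<exists>g\<in>palindromic_endos. \<forall>i\<in>{1..n}. f (g (x i)) = x i"
proof -
  have "\<exists>g\<in>palindromic_endos. \<forall>i\<in>{1..n}.
    lower_central_class G m (f (g (x i))) = lower_central_class G m (x i)" if "2 \<le> m" for m
    using that
  proof (induction m rule: dec_induct)
    case base
    then show ?case
      by (rule palindromic_auto_inverse_mod_derived[OF f])
  next
    case (step m)
    then show ?case
      using palindromic_inverse_lift[OF f(2)] by blast
  qed
  from this[of "Suc k"] assms(3) obtain g where g: "g \<in> palindromic_endos"
    "\<forall>i\<in>{1..n}. lower_central_class G (Suc k) (f (g (x i))) = lower_central_class G (Suc k) (x i)"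
    by auto
  have "f (g (x i)) = x i" if i: "i \<in> {1..n}" for i
  proof -
    have "f (g (x i)) \<in> carrier G"
      using i pal_closed palindromic_endos_compose[OF f(2) g(1)] by (auto simp: palindromic_endos_def)
    then show ?thesis
      using g(2) i lower_central_class_eq_iff[of "f (g (x i))" "x i" "Suc k"] by (auto simp: nilpotent)
  qed
  then show ?thesis using g(1) by blast
qed

lemma palindromic_autos_subgroup:
  assumes "k \<ge> 1"
  shows "subgroup {f \<in> auto G. \<forall>i\<in>{1..n}. pal (f (x i))} (AutoGroup G)"
proof -
  interpret A: group "AutoGroup G" by (rule AutoGroup)
  have mult: "f \<otimes>\<^bsub>AutoGroup G\<^esub> g = compose (carrier G) f g" if "f \<in> auto G" "g \<in> auto G" for f g
    using that by (auto simp: AutoGroup_def BijGroup_def auto_def)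
  have one: "\<one>\<^bsub>AutoGroup G\<^esub> = (\<lambda>a\<in>carrier G. a)"
    by (simp add: AutoGroup_def BijGroup_def)
  have carrier: "carrier (AutoGroup G) = auto G"
    by (simp add: AutoGroup_def)
  have endo: "f \<in> palindromic_endos" if "f \<in> auto G" "\<forall>i\<in>{1..n}. pal (f (x i))" for f
    using that by (auto simp: palindromic_endos_def auto_def)
  show ?thesis
  proof (rule A.subgroupI)
    show "{f \<in> auto G. \<forall>i\<in>{1..n}. pal (f (x i))} \<subseteq> carrier (AutoGroup G)"
      by (auto simp: carrier)
    have "\<one>\<^bsub>AutoGroup G\<^esub> \<in> {f \<in> auto G. \<forall>i\<in>{1..n}. pal (f (x i))}"
      using id_in_auto by (auto simp: one pal_basis)
    then show "{f \<in> auto G. \<forall>i\<in>{1..n}. pal (f (x i))} \<noteq> {}" by blast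
  next
    fix f assume "f \<in> {f \<in> auto G. \<forall>i\<in>{1..n}. pal (f (x i))}"
    then have f: "f \<in> auto G" "f \<in> palindromic_endos"
      using endo by auto
    let ?f' = "inv\<^bsub>AutoGroup G\<^esub> f"
    have f': "?f' \<in> auto G"
      using A.inv_closed f(1) by (simp add: carrier)
    obtain g where g: "g \<in> palindromic_endos" "\<forall>i\<in>{1..n}. f (g (x i)) = x i"
      using palindromic_auto_right_inverse[OF f assms] by blast
    have "pal (?f' (x i))" if i: "i \<in> {1..n}" for i
    proof -
      have pal: "pal (g (x i))" using g(1) i by (auto simp: palindromic_endos_def)
      have "compose (carrier G) ?f' f = (\<lambda>a\<in>carrier G. a)"
        using A.l_inv[of f] f(1) mult[OF f' f(1)] one by (simp add: carrier)
      then have "?f' (f (g (x i))) = g (x i)"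
        using pal_closed[OF pal] by (metis compose_eq restrict_apply')
      then show ?thesis using g(2) i pal by simp
    qed
    then show "?f' \<in> {f \<in> auto G. \<forall>i\<in>{1..n}. pal (f (x i))}"
      using f' by blast
  next
    fix f g assume "f \<in> {f \<in> auto G. \<forall>i\<in>{1..n}. pal (f (x i))}" "g \<in> {f \<in> auto G. \<forall>i\<in>{1..n}. pal (f (x i))}"
    then have fg: "f \<in> auto G" "g \<in> auto G" "f \<in> palindromic_endos" "\<forall>i\<in>{1..n}. pal (g (x i))"
      using endo by auto
    have "f \<otimes>\<^bsub>AutoGroup G\<^esub> g \<in> auto G"
      using A.m_closed fg by (simp add: carrier)
    moreover have "\<forall>i\<in>{1..n}. pal ((f \<otimes>\<^bsub>AutoGroup G\<^esub> g) (x i))"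
      using fg palindromic_endo_pal[OF fg(3)] by (simp add: mult compose_eq)
    ultimately show "f \<otimes>\<^bsub>AutoGroup G\<^esub> g \<in> {f \<in> auto G. \<forall>i\<in>{1..n}. pal (f (x i))}" by blast
  qed
qed

end

section \<open>The free group and its universal property\<close>

abbreviation free_class :: "nat \<Rightarrow> letter list \<Rightarrow> letter list set" where
  "free_class n w \<equiv> free_rel n `` {w}"

lemma free_rel_words: "(u, v) \<in> free_rel n \<Longrightarrow> u \<in> words n \<and> v \<in> words n"
  by (induction rule: free_rel.induct) auto

lemma equiv_free_rel: "equiv (words n) (free_rel n)"
proof (rule equivI)
  show "free_rel n \<subseteq> words n \<times> words n"
    using free_rel_words by auto
  show "refl_on (words n) (free_rel n)"
    using free_rel_words by (auto intro!: refl_onI free_rel.refl)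
  show "sym (free_rel n)"
    by (auto intro!: symI intro: free_rel.sym)
  show "trans (free_rel n)"
    by (auto intro!: transI intro: free_rel.trans)
qed

lemma free_rel_context:
  assumes "(u, v) \<in> free_rel n" "s \<in> words n" "t \<in> words n"
  shows "(s @ u @ t, s @ v @ t) \<in> free_rel n"
  using assms
proof (induction rule: free_rel.induct)
  case (cancel u v i e)
  then have "((s @ u) @ [(i, e), (i, \<not> e)] @ (v @ t), (s @ u) @ (v @ t)) \<in> free_rel n"
    by (intro free_rel.cancel) auto
  then show ?case by simp
qed (auto intro: free_rel.intros)

lemma free_rel_append:
  assumes "(u, u') \<in> free_rel n" "(v, v') \<in> free_rel n"
  shows "(u @ v, u' @ v') \<in> free_rel n"
proof -
  have "(u @ v, u' @ v) \<in> free_rel n" "(u' @ v, u' @ v') \<in> free_rel n"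
    using free_rel_context[OF assms(1), of "[]" v] free_rel_context[OF assms(2), of u' "[]"]
      free_rel_words[OF assms(1)] free_rel_words[OF assms(2)] by auto
  then show ?thesis by (rule free_rel.trans)
qed

lemma free_rel_inverse: "w \<in> words n \<Longrightarrow> (rev (flip_word w) @ w, []) \<in> free_rel n"
proof (induction w)
  case Nil
  then show ?case by (simp add: free_rel.refl)
next
  case (Cons l w)
  obtain i e where l: "l = (i, e)" by (cases l)
  have "(rev (flip_word w) @ [(i, \<not> e), (i, \<not> \<not> e)] @ w, rev (flip_word w) @ w) \<in> free_rel n"
    using Cons.prems by (intro free_rel.cancel) (auto simp: l)
  moreover have "(rev (flip_word w) @ w, []) \<in> free_rel n"
    using Cons by (simp add: l)
  ultimately have "(rev (flip_word w) @ [(i, \<not> e), (i, \<not> \<not> e)] @ w, []) \<in> free_rel n"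
    by (rule free_rel.trans)
  then show ?case by (simp add: l)
qed

lemma carrier_free_group: "carrier (free_group n) = free_class n ` words n"
  by (auto simp: free_group_def quotient_def)

lemma one_free_group: "\<one>\<^bsub>free_group n\<^esub> = free_class n []"
  by (simp add: free_group_def)

lemma mult_free_group:
  assumes "u \<in> words n" "v \<in> words n"
  shows "free_class n u \<otimes>\<^bsub>free_group n\<^esub> free_class n v = free_class n (u @ v)"
proof -
  have "congruent2 (free_rel n) (free_rel n) (\<lambda>u v. free_class n (u @ v))"
    by (auto simp: congruent2_def intro!: equiv_class_eq[OF equiv_free_rel] free_rel_append)
  then show ?thesis
    using UN_equiv_class2[OF equiv_free_rel equiv_free_rel _ assms] by (simp add: free_group_def)
qed

lemma group_free_group: "group (free_group n)"
proof (rule groupI)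
  fix a assume "a \<in> carrier (free_group n)"
  then obtain w where w: "w \<in> words n" "a = free_class n w"
    by (auto simp: carrier_free_group)
  then have "free_class n (rev (flip_word w)) \<otimes>\<^bsub>free_group n\<^esub> a = \<one>\<^bsub>free_group n\<^esub>"
    using equiv_class_eq[OF equiv_free_rel free_rel_inverse[OF w(1)]]
    by (simp add: mult_free_group one_free_group)
  then show "\<exists>b\<in>carrier (free_group n). b \<otimes>\<^bsub>free_group n\<^esub> a = \<one>\<^bsub>free_group n\<^esub>"
    using w by (auto simp: carrier_free_group)
qed (auto simp: carrier_free_group mult_free_group one_free_group)

lemma word_value_free_gen:
  assumes "w \<in> words n"
  shows "word_value (free_group n) (free_gen n) w = free_class n w"
  using assms
proof (induction w)
  case (Cons l w)
  interpret F: group "free_group n" by (rule group_free_group)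
  obtain i e where l: "l = (i, e)" by (cases l)
  have i: "i \<in> {1..n}" "w \<in> words n" using Cons.prems by (auto simp: l)
  have "free_class n [(i, False)] \<otimes>\<^bsub>free_group n\<^esub> free_gen n i = \<one>\<^bsub>free_group n\<^esub>"
    using equiv_class_eq[OF equiv_free_rel free_rel_inverse[of "[(i, True)]" n]] i
    by (simp add: mult_free_group one_free_group free_gen_def)
  then have "inv\<^bsub>free_group n\<^esub> free_gen n i = free_class n [(i, False)]"
    using i by (intro F.inv_equality) (auto simp: carrier_free_group free_gen_def)
  then have "(if e then free_gen n i else inv\<^bsub>free_group n\<^esub> free_gen n i) = free_class n [l]"
    by (simp add: l free_gen_def)
  then show ?case
    using Cons i mult_free_group[of "[l]" n w] by (simp add: l)
qed (simp add: one_free_group)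

lemma (in group) word_value_free_rel:
  assumes "(u, v) \<in> free_rel n" and f: "f \<in> {1..n} \<rightarrow> carrier G"
  shows "word_value G f u = word_value G f v"
  using assms(1)
proof (induction rule: free_rel.induct)
  case (cancel u v i e)
  then have "f i \<in> carrier G" using f by auto
  then have "word_value G f ([(i, e), (i, \<not> e)] @ v) = word_value G f v"
    using cancel f by auto
  then show ?case
    using cancel f by (simp only: word_value_append[OF f] words_append) (simp add: word_value_append[OF f])
qed auto

lemma (in group) free_group_extend:
  assumes f: "f \<in> {1..n} \<rightarrow> carrier G"
  shows "\<exists>h\<in>hom (free_group n) G. \<forall>w\<in>words n. h (free_class n w) = word_value G f w"
proof -
  define h where "h A = the_elem (word_value G f ` A)" for A
  have h: "h (free_class n w) = word_value G f w" if w: "w \<in> words n" for w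
  proof -
    have "word_value G f v = word_value G f w" if "v \<in> free_class n w" for v
      using word_value_free_rel[OF _ f, of w v] that by simp
    moreover have "w \<in> free_class n w"
      using free_rel.refl[OF w] by simp
    ultimately have "word_value G f ` free_class n w = {word_value G f w}"
      by blast
    then show ?thesis by (simp add: h_def)
  qed
  moreover have "h \<in> hom (free_group n) G"
    by (rule homI) (use f in \<open>auto simp: carrier_free_group mult_free_group h word_value_append[OF f]\<close>)
  ultimately show ?thesis by blast
qed

section \<open>The palindromic automorphism group of the free nilpotent group\<close>

text \<open>A map from the basis to \<open>N\<close> extends to the free group, and the extension kills \<open>\<gamma>\<^sub>k\<^sub>+\<^sub>1\<close> of the
  free group because it sends it into \<open>\<gamma>\<^sub>k\<^sub>+\<^sub>1 N\<close>, which is trivial; so it factors through \<open>N\<close>.\<close>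

lemma free_nilpotent_basis: "free_nilpotent_basis (free_nilpotent n k) (nilpotent_gen n k) n k"
proof -
  define F where "F = free_group n"
  define N where "N = free_nilpotent n k"
  define p where "p = lower_central_class F (Suc k)"
  interpret F: group F unfolding F_def by (rule group_free_group)
  have N: "N = F Mod lower_central F (Suc k)"
    by (simp add: N_def F_def free_nilpotent_def)
  interpret p: group_hom F N p
    unfolding N p_def by (rule F.lower_central_quotient_hom)
  have surj: "p ` carrier F = carrier N"
    by (simp add: N p_def carrier_FactGroup)
  have gen: "nilpotent_gen n k = (\<lambda>i. p (free_gen n i))"
    by (rule ext) (simp add: nilpotent_gen_def p_def F_def)
  have free_gen: "free_gen n \<in> {1..n} \<rightarrow> carrier F"
    by (auto simp: F_def carrier_free_group free_gen_def)
  have "p ` lower_central F (Suc k) \<subseteq> {\<one>\<^bsub>N\<^esub>}"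
  proof clarify
    fix z assume z: "z \<in> lower_central F (Suc k)"
    then have "z \<in> carrier F" using F.lower_central_subset by blast
    then show "p z = \<one>\<^bsub>N\<^esub>"
      using F.coset_join2[OF _ F.lower_central_subgroup z] by (simp add: p_def N)
  qed
  then have nilp: "lower_central N (Suc k) = {\<one>\<^bsub>N\<^esub>}"
    using p.surj_lower_central_subset[OF surj, of "Suc k"]
      subgroup.one_closed[OF p.H.lower_central_subgroup, of "Suc k"] by blast
  have "free_nilpotent_basis N (nilpotent_gen n k) n k"
  proof (unfold_locales)
    show "nilpotent_gen n k \<in> {1..n} \<rightarrow> carrier N"
      using p.hom_closed[OF funcset_mem[OF free_gen]] by (auto simp: gen)
    show "\<exists>w\<in>words n. word_value N (nilpotent_gen n k) w = g" if g: "g \<in> carrier N" for g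
    proof -
      obtain a where "a \<in> carrier F" and ga: "g = p a" using g surj by blast
      then obtain w where w: "w \<in> words n" "a = free_class n w"
        by (auto simp: F_def carrier_free_group)
      then have "p (word_value F (free_gen n) w) = g"
        using ga by (simp add: word_value_free_gen F_def)
      then show ?thesis
        using p.hom_word_value[OF free_gen w(1)] w(1) by (auto simp: gen)
    qed
    show "\<exists>h\<in>hom N N. \<forall>i\<in>{1..n}. h (nilpotent_gen n k i) = f i" if f: "f \<in> {1..n} \<rightarrow> carrier N" for f
    proof -
      obtain h where h: "h \<in> hom F N" "\<forall>w\<in>words n. h (free_class n w) = word_value N f w"
        using p.H.free_group_extend[OF f] unfolding F_def by blast
      interpret h: group_hom F N h by unfold_locales (rule h(1))
      have kills: "h a = h b" if ab: "a \<in> carrier F" "b \<in> carrier F"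
        "lower_central_class F (Suc k) a = lower_central_class F (Suc k) b" for a b
      proof -
        obtain z where z: "z \<in> lower_central F (Suc k)" "a = z \<otimes>\<^bsub>F\<^esub> b"
          using ab by (auto simp: F.lower_central_class_eq_iff)
        have "z \<in> carrier F" using z(1) F.lower_central_subset by blast
        moreover have "h z = \<one>\<^bsub>N\<^esub>"
          using h.hom_lower_central_subset[of "Suc k"] z(1) unfolding nilp by blast
        ultimately show ?thesis using z(2) ab by simp
      qed
      obtain g where g: "g \<in> hom N N" "\<And>a. a \<in> carrier F \<Longrightarrow> g (p a) = h a"
        using FactGroup_universal[OF h(1) F.lower_central_normal kills] unfolding N p_def by blast
      have "g (nilpotent_gen n k i) = f i" if i: "i \<in> {1..n}" for i
      proof -
        have "free_gen n i \<in> carrier F" "f i \<in> carrier N" using free_gen f i by auto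
        then show ?thesis
          using g(2)[of "free_gen n i"] bspec[OF h(2), of "[(i, True)]"] i by (simp add: gen free_gen_def)
      qed
      then show ?thesis using g(1) by blast
    qed
  qed (rule nilp)
  then show ?thesis by (simp add: N_def)
qed

theorem theorem2p1:
  fixes n k :: nat
  assumes "n \<ge> 1" and "k \<ge> 1"
  shows "Group.group (palindromic_auto_monoid n k)"
proof -
  interpret N: free_nilpotent_basis "free_nilpotent n k" "nilpotent_gen n k" n k
    by (rule free_nilpotent_basis)
  have "palindrome n k = N.pal"
    by (auto simp: palindrome_def N.pal_def)
  then have "palindromic_autos n k
      = {f \<in> auto (free_nilpotent n k). \<forall>i\<in>{1..n}. N.pal (f (nilpotent_gen n k i))}"
    by (simp add: palindromic_autos_def)
  then have "subgroup (palindromic_autos n k) (AutoGroup (free_nilpotent n k))"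
    using N.palindromic_autos_subgroup[OF assms(2)] by simp
  then show ?thesis
    unfolding palindromic_auto_monoid_def
    by (rule subgroup.subgroup_is_group) (rule N.AutoGroup)
qed

end
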